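(* Let $L=L(a,b)$ be the free Lie ring (Lie algebra over $\mathbb{Z}$) on two letters $a,b$, and let $I_{2,m}$ be the kernel of the map $\Theta_{2,m}:L_{1,m}\oplus L_{2,m-1}\to L_{2,m}$, $\Theta_{2,m}(A,B)=[A,a]+[B,b]$. Then for every integer $m\ge 1$: if $m$ is odd, $I_{2,m}=0$; if $m$ is even, $I_{2,m}$ is the subgroup generated by the single element $$\left(C_m,\ \sum_{i=1}^{m/2}(-1)^i\,[C_{m-i},\,C_{i-1}]\right).$$
   Context: $L_{k,m}\subseteq L$ denotes the abelian subgroup generated by all iterated commutators in which $a$ occurs exactly $k$ times and $b$ occurs exactly $m$ times. For $n\ge0$, $C_n=[a,_n b]$, i.e. $C_0=a$ and $C_{n+1}=[C_n,b]$. $\langle x\rangle$-type generation is as an abelian group. *)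

theory Defs
  imports
    "HOL-Library.Product_Plus"
    "HOL-Computational_Algebra.Group_Closure"
begin

section \<open>Lie rings\<close>

class lie_ring = ab_group_add +
  fixes lie_bracket :: "'a \<Rightarrow> 'a \<Rightarrow> 'a"  (\<open>[_, _]\<^sub>L\<close>)
  assumes lie_add_left: "[x + y, z]\<^sub>L = [x, z]\<^sub>L + [y, z]\<^sub>L"
    and lie_add_right: "[x, y + z]\<^sub>L = [x, y]\<^sub>L + [x, z]\<^sub>L"
    and lie_self: "[x, x]\<^sub>L = 0"
    and lie_jacobi: "[x, [y, z]\<^sub>L]\<^sub>L + [y, [z, x]\<^sub>L]\<^sub>L + [z, [x, y]\<^sub>L]\<^sub>L = 0"

definition lie_hom :: "('a::lie_ring \<Rightarrow> 'b::lie_ring) \<Rightarrow> bool" where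
  "lie_hom h \<longleftrightarrow> (\<forall>x y. h (x + y) = h x + h y) \<and> (\<forall>x y. h [x, y]\<^sub>L = [h x, h y]\<^sub>L)"


section \<open>The free Lie ring on an alphabet\<close>

text \<open>
  The free Lie ring is the term algebra in the signature of Lie rings, modulo the
  congruence generated by the Lie ring axioms.
\<close>

datatype 'x lie_term =
    Gen 'x
  | Zero
  | Neg "'x lie_term"
  | Add "'x lie_term" "'x lie_term"
  | Br "'x lie_term" "'x lie_term"

inductive lie_eq :: "'x lie_term \<Rightarrow> 'x lie_term \<Rightarrow> bool" where
  refl: "lie_eq s s"
| sym: "lie_eq s t \<Longrightarrow> lie_eq t s"
| trans: "lie_eq s t \<Longrightarrow> lie_eq t u \<Longrightarrow> lie_eq s u"
| cong_Neg: "lie_eq s s' \<Longrightarrow> lie_eq (Neg s) (Neg s')"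
| cong_Add: "lie_eq s s' \<Longrightarrow> lie_eq t t' \<Longrightarrow> lie_eq (Add s t) (Add s' t')"
| cong_Br: "lie_eq s s' \<Longrightarrow> lie_eq t t' \<Longrightarrow> lie_eq (Br s t) (Br s' t')"
| add_assoc: "lie_eq (Add (Add s t) u) (Add s (Add t u))"
| add_comm: "lie_eq (Add s t) (Add t s)"
| add_zero: "lie_eq (Add Zero s) s"
| add_neg: "lie_eq (Add (Neg s) s) Zero"
| br_add_left: "lie_eq (Br (Add s t) u) (Add (Br s u) (Br t u))"
| br_add_right: "lie_eq (Br s (Add t u)) (Add (Br s t) (Br s u))"
| br_self: "lie_eq (Br s s) Zero"
| jacobi: "lie_eq (Add (Add (Br s (Br t u)) (Br t (Br u s))) (Br u (Br s t))) Zero"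

quotient_type 'x free_lie = "'x lie_term" / lie_eq
  by (rule equivpI) (auto intro: reflpI sympI transpI lie_eq.refl lie_eq.sym lie_eq.trans)

instantiation free_lie :: (type) lie_ring
begin

lift_definition zero_free_lie :: "'a free_lie" is Zero .

lift_definition uminus_free_lie :: "'a free_lie \<Rightarrow> 'a free_lie" is Neg
  by (rule lie_eq.cong_Neg)

lift_definition plus_free_lie :: "'a free_lie \<Rightarrow> 'a free_lie \<Rightarrow> 'a free_lie" is Add
  by (rule lie_eq.cong_Add)

definition minus_free_lie :: "'a free_lie \<Rightarrow> 'a free_lie \<Rightarrow> 'a free_lie" where
  "minus_free_lie x y = x + - y"

lift_definition lie_bracket_free_lie :: "'a free_lie \<Rightarrow> 'a free_lie \<Rightarrow> 'a free_lie" is Br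
  by (rule lie_eq.cong_Br)

instance
proof
  fix x y z :: "'a free_lie"
  show "x + y + z = x + (y + z)" by transfer (rule lie_eq.add_assoc)
  show "x + y = y + x" by transfer (rule lie_eq.add_comm)
  show "0 + x = x" by transfer (rule lie_eq.add_zero)
  show "- x + x = 0" by transfer (rule lie_eq.add_neg)
  show "x - y = x + - y" by (rule minus_free_lie_def)
  show "[x + y, z]\<^sub>L = [x, z]\<^sub>L + [y, z]\<^sub>L" by transfer (rule lie_eq.br_add_left)
  show "[x, y + z]\<^sub>L = [x, y]\<^sub>L + [x, z]\<^sub>L" by transfer (rule lie_eq.br_add_right)
  show "[x, x]\<^sub>L = 0" by transfer (rule lie_eq.br_self)
  show "[x, [y, z]\<^sub>L]\<^sub>L + [y, [z, x]\<^sub>L]\<^sub>L + [z, [x, y]\<^sub>L]\<^sub>L = 0"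
    by transfer (rule lie_eq.jacobi)
qed

end

lift_definition free_gen :: "'x \<Rightarrow> 'x free_lie" is Gen .

primrec eval_lie_term :: "('x \<Rightarrow> 'b::lie_ring) \<Rightarrow> 'x lie_term \<Rightarrow> 'b" where
  "eval_lie_term f (Gen x) = f x"
| "eval_lie_term f Zero = 0"
| "eval_lie_term f (Neg s) = - eval_lie_term f s"
| "eval_lie_term f (Add s t) = eval_lie_term f s + eval_lie_term f t"
| "eval_lie_term f (Br s t) = [eval_lie_term f s, eval_lie_term f t]\<^sub>L"

lemma eval_lie_term_cong: "lie_eq s t \<Longrightarrow> eval_lie_term f s = eval_lie_term f t"
  by (induction rule: lie_eq.induct)
    (simp_all add: algebra_simps lie_add_left lie_add_right lie_self lie_jacobi[unfolded add.assoc])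

lift_definition free_lie_lift :: "('x \<Rightarrow> 'b::lie_ring) \<Rightarrow> 'x free_lie \<Rightarrow> 'b"
  is eval_lie_term
  by (rule eval_lie_term_cong)

theorem free_lie_universal:
  fixes f :: "'x \<Rightarrow> 'b::lie_ring"
  shows "\<exists>!h. lie_hom h \<and> (\<forall>x. h (free_gen x) = f x)"
proof (rule ex1I)
  show "lie_hom (free_lie_lift f) \<and> (\<forall>x. free_lie_lift f (free_gen x) = f x)"
    unfolding lie_hom_def by (intro conjI allI; transfer) simp_all
next
  fix h :: "'x free_lie \<Rightarrow> 'b"
  assume h: "lie_hom h \<and> (\<forall>x. h (free_gen x) = f x)"
  then have add: "h (x + y) = h x + h y" and br: "h [x, y]\<^sub>L = [h x, h y]\<^sub>L" for x y
    unfolding lie_hom_def by auto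
  have zero: "h 0 = 0" using add[of 0 0] by simp
  have neg: "h (- x) = - h x" for x
    using add[of "- x" x] zero by (simp add: eq_neg_iff_add_eq_0)
  have "h (abs_free_lie t) = free_lie_lift f (abs_free_lie t)" for t
  proof (induction t)
    case (Gen x)
    then show ?case using h by (simp add: free_gen.abs_eq[symmetric] free_lie_lift.abs_eq)
      (simp add: free_gen.abs_eq free_lie_lift.abs_eq)
  next
    case Zero
    then show ?case
      by (simp add: zero zero_free_lie.abs_eq[symmetric]) (simp add: zero_free_lie.abs_eq free_lie_lift.abs_eq)
  next
    case (Neg t)
    then show ?case
      by (simp add: neg uminus_free_lie.abs_eq[symmetric] del: eval_lie_term.simps)
        (simp add: uminus_free_lie.abs_eq free_lie_lift.abs_eq)
  next
    case (Add s t)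
    then show ?case
      by (simp add: add plus_free_lie.abs_eq[symmetric])
        (simp add: plus_free_lie.abs_eq free_lie_lift.abs_eq)
  next
    case (Br s t)
    then show ?case
      by (simp add: br lie_bracket_free_lie.abs_eq[symmetric])
        (simp add: lie_bracket_free_lie.abs_eq free_lie_lift.abs_eq)
  qed
  then have "h x = free_lie_lift f x" for x
    by (induction x rule: free_lie.abs_induct)
  then show "h = free_lie_lift f" ..
qed


section \<open>Two generators\<close>

datatype letter = letter_a | letter_b

type_synonym L = "letter free_lie"

definition gen_a :: L where "gen_a = free_gen letter_a"

definition gen_b :: L where "gen_b = free_gen letter_b"

text \<open>
  \<open>iter_comm k m x\<close>: \<open>x\<close> is the value of an iterated commutator, with an arbitrary
  arrangement of brackets, in which the letter \<open>a\<close> occurs exactly \<open>k\<close> times and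
  the letter \<open>b\<close> exactly \<open>m\<close> times.
\<close>

inductive iter_comm :: "nat \<Rightarrow> nat \<Rightarrow> L \<Rightarrow> bool" where
  letter_a: "iter_comm 1 0 gen_a"
| letter_b: "iter_comm 0 1 gen_b"
| bracket: "iter_comm k m x \<Longrightarrow> iter_comm k' m' y \<Longrightarrow> iter_comm (k + k') (m + m') [x, y]\<^sub>L"

definition L_deg :: "nat \<Rightarrow> nat \<Rightarrow> L set" where
  "L_deg k m = group_closure {x. iter_comm k m x}"

primrec C :: "nat \<Rightarrow> L" where
  "C 0 = gen_a"
| "C (Suc n) = [C n, gen_b]\<^sub>L"

definition Theta :: "L \<times> L \<Rightarrow> L" where
  "Theta = (\<lambda>(A, B). [A, gen_a]\<^sub>L + [B, gen_b]\<^sub>L)"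

text \<open>The kernel of \<open>Theta\<close> on the direct sum of \<open>L_deg 1 m\<close> and
  \<open>L_deg 2 (m - 1)\<close>; meaningful for \<open>m \<ge> 1\<close>.\<close>

definition I2 :: "nat \<Rightarrow> (L \<times> L) set" where
  "I2 m = {p \<in> L_deg 1 m \<times> L_deg 2 (m - 1). Theta p = 0}"

lemma lie_diff_left: "[x - y, z]\<^sub>L = [x, z]\<^sub>L - [y, z]\<^sub>L" for x :: "'a::lie_ring"
  using lie_add_left[of "x - y" y z] by (simp add: algebra_simps)

lemma L_deg_bracket_iter_comm:
  assumes "x \<in> L_deg k m" "iter_comm k' m' y"
  shows "[x, y]\<^sub>L \<in> L_deg (k + k') (m + m')"
  using assms(1) unfolding L_deg_def
proof (induction rule: group_closure.induct)
  case (base s)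
  have "[0, y]\<^sub>L = 0" using lie_diff_left[of 0 0 y] by simp
  with base show ?case
    using iter_comm.bracket[OF _ assms(2)] by (auto intro!: group_closure.base)
next
  case (diff s t)
  then show ?case by (simp add: lie_diff_left group_closure.diff)
qed

lemma Theta_in_L_deg:
  assumes "m \<ge> 1" "p \<in> L_deg 1 m \<times> L_deg 2 (m - 1)"
  shows "Theta p \<in> L_deg 2 m"
proof -
  obtain A B where p: "p = (A, B)" "A \<in> L_deg 1 m" "B \<in> L_deg 2 (m - 1)"
    using assms(2) by auto
  have "[A, gen_a]\<^sub>L \<in> L_deg 2 m"
    using L_deg_bracket_iter_comm[OF p(2) iter_comm.letter_a] by (simp add: numeral_2_eq_2)
  moreover have "[B, gen_b]\<^sub>L \<in> L_deg 2 m"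
    using L_deg_bracket_iter_comm[OF p(3) iter_comm.letter_b] assms(1) by simp
  ultimately show ?thesis
    unfolding p(1) Theta_def L_deg_def by (simp add: group_closure_add)
qed

end

theory Submission
  imports Defs "HOL-Computational_Algebra.Polynomial"
begin

text \<open>
  The group \<open>L_deg 1 m\<close> is spanned by \<open>C m\<close>, and \<open>L_deg 2 m\<close> by the brackets
  \<open>[C (m - j), C j]\<close> with \<open>2 j < m\<close>. To see that these are independent, map \<open>L\<close> to a small
  Lie ring over the polynomials in \<open>X\<close>, in which \<open>[C i, C j]\<close> becomes \<open>X^i - X^j\<close> and
  bracketing with \<open>b\<close> becomes multiplication by \<open>X + 1\<close> in degree 2. As \<open>X + 1\<close> is not a zero
  divisor, an element of the kernel is determined by its first component \<open>c C m\<close>, and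
  evaluation at \<open>X = -1\<close> shows that \<open>c = 0\<close> if \<open>m\<close> is odd. If \<open>m\<close> is even, then the given
  element is in the kernel by a telescoping sum.
\<close>

section \<open>Integer multiples\<close>

definition int_scale :: "int \<Rightarrow> 'a::ab_group_add \<Rightarrow> 'a" where
  "int_scale k x = (if k \<ge> 0 then \<Sum>i<nat k. x else - (\<Sum>i<nat (- k). x))"

lemma int_scale_0 [simp]: "int_scale 0 x = 0"
  and int_scale_1 [simp]: "int_scale 1 x = x"
  by (simp_all add: int_scale_def)

lemma int_scale_add_1: "int_scale (k + 1) x = int_scale k x + x"
proof (cases "k \<ge> 0")
  case True
  then have "nat (k + 1) = Suc (nat k)" by simp
  with True show ?thesis by (simp add: int_scale_def)
next
  case False
  then have "nat (- k) = Suc (nat (- (k + 1)))" by simp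
  with False show ?thesis by (cases "k = -1") (simp_all add: int_scale_def)
qed

lemma int_scale_add: "int_scale (k + l) x = int_scale k x + int_scale l x"
proof (induction l rule: int_induct[where k = 0])
  case (step1 i)
  then show ?case using int_scale_add_1[of "k + i" x] int_scale_add_1[of i x]
    by (simp add: algebra_simps)
next
  case (step2 i)
  then show ?case using int_scale_add_1[of "k + (i - 1)" x] int_scale_add_1[of "i - 1" x]
    by (simp add: algebra_simps)
qed simp

lemma int_scale_diff: "int_scale (k - l) x = int_scale k x - int_scale l x"
  using int_scale_add[of "k - l" l x] by (simp add: algebra_simps)

text \<open>Both x and the sum of \<open>int_scale (\<phi> i x) (s i)\<close> over J are additive in
  x, and they agree on the generators by duality, hence on the whole span. Dual functionals thus
  give a coordinate expansion without a separate proof of independence.\<close>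

lemma group_closure_eq_0_if_coordinates_0:
  fixes \<phi> :: "'i \<Rightarrow> 'a::ab_group_add \<Rightarrow> int"
  assumes "finite J"
    and add: "\<And>i x y. \<phi> i (x - y) = \<phi> i x - \<phi> i y"
    and dual: "\<And>i j. i \<in> J \<Longrightarrow> j \<in> J \<Longrightarrow> \<phi> i (s j) = (if i = j then 1 else 0)"
    and x: "x \<in> group_closure (s ` J)"
    and zero: "\<And>i. i \<in> J \<Longrightarrow> \<phi> i x = 0"
  shows "x = 0"
proof -
  have 0: "\<phi> i 0 = 0" for i using add[of i 0 0] by simp
  from x have "x = (\<Sum>i\<in>J. int_scale (\<phi> i x) (s i))"
  proof (induction rule: group_closure.induct)
    case (base t)
    show ?case
    proof (cases "t = 0")
      case True
      then show ?thesis by (simp add: 0)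
    next
      case False
      with base obtain j where j: "j \<in> J" "t = s j" by auto
      have "(\<Sum>i\<in>J. int_scale (\<phi> i t) (s i)) = (\<Sum>i\<in>J. if i = j then s i else 0)"
        using j by (intro sum.cong) (auto simp: dual)
      then show ?thesis using j \<open>finite J\<close> by simp
    qed
  next
    case (diff u v)
    then show ?case by (simp add: add int_scale_diff sum_subtractf)
  qed
  then show ?thesis by (simp add: zero)
qed


section \<open>Spanning sets\<close>

lemma lie_diff_right: "[x, y - z]\<^sub>L = [x, y]\<^sub>L - [x, z]\<^sub>L" for x :: "'a::lie_ring"
  using lie_add_right[of x "y - z" z] by (simp add: algebra_simps)

lemma lie_zero_left [simp]: "[0, x]\<^sub>L = 0" for x :: "'a::lie_ring"
  using lie_diff_left[of x x x] by simp

lemma lie_zero_right [simp]: "[x, 0]\<^sub>L = 0" for x :: "'a::lie_ring"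
  using lie_diff_right[of x x x] by simp

lemma lie_neg_left: "[- x, y]\<^sub>L = - [x, y]\<^sub>L" for x :: "'a::lie_ring"
  using lie_diff_left[of 0 x y] by simp

lemma lie_antisym: "[x, y]\<^sub>L = - [y, x]\<^sub>L" for x :: "'a::lie_ring"
proof -
  have "[x + y, x + y]\<^sub>L = [x, y]\<^sub>L + [y, x]\<^sub>L"
    unfolding lie_add_left lie_add_right by (simp add: lie_self)
  then show ?thesis by (simp add: lie_self eq_neg_iff_add_eq_0)
qed

text \<open>Jacobi rearranged by antisymmetry; with z = b it pushes a bracket with b into both
  factors.\<close>

lemma lie_derivation:
  "[[x, y]\<^sub>L, z]\<^sub>L = [[x, z]\<^sub>L, y]\<^sub>L + [x, [y, z]\<^sub>L]\<^sub>L" for x :: "'a::lie_ring"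
  using lie_jacobi[of x y z] lie_antisym[of y "[z, x]\<^sub>L"] lie_antisym[of z "[x, y]\<^sub>L"]
    lie_antisym[of z x] lie_neg_left[of "[x, z]\<^sub>L" y]
  by (simp add: algebra_simps)

lemma lie_sum_left: "[sum f I, x]\<^sub>L = (\<Sum>i\<in>I. [f i, x]\<^sub>L)" for x :: "'a::lie_ring"
  by (induction I rule: infinite_finite_induct) (simp_all add: lie_add_left)

lemma group_closure_lie_bracket:
  fixes S T U :: "'a::lie_ring set"
  assumes gen: "\<And>s t. s \<in> S \<Longrightarrow> t \<in> T \<Longrightarrow> [s, t]\<^sub>L \<in> group_closure U"
    and x: "x \<in> group_closure S" and y: "y \<in> group_closure T"
  shows "[x, y]\<^sub>L \<in> group_closure U"
  using x
proof (induction rule: group_closure.induct)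
  case (base s)
  from y show ?case
  proof (induction rule: group_closure.induct)
    case (base t)
    then show ?case using gen \<open>s \<in> insert 0 S\<close> by auto
  qed (simp add: lie_diff_right group_closure.diff)
qed (simp add: lie_diff_left group_closure.diff)

text \<open>Antisymmetry leaves one bracket of each pair, and the middle one with 2 j = m vanishes.
  The strict bound keeps the exponents j and m - j apart in the polynomial model.\<close>

definition brackets2 :: "nat \<Rightarrow> L set" where
  "brackets2 m = (\<lambda>j. [C (m - j), C j]\<^sub>L) ` {j. 2 * j < m}"

lemma C_bracket_in_brackets2: "[C i, C j]\<^sub>L \<in> group_closure (brackets2 (i + j))"
proof -
  have *: "[C i, C j]\<^sub>L \<in> group_closure (brackets2 (i + j))" if "j < i" for i j
    using that unfolding brackets2_def
    by (intro group_closure.base insertI2 image_eqI[where x = j]) auto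
  consider "j < i" | "i = j" | "i < j" by linarith
  then show ?thesis
  proof cases
    case 3
    then have "- [C j, C i]\<^sub>L \<in> group_closure (brackets2 (i + j))"
      using *[of i j] by (simp add: add.commute)
    then show ?thesis by (metis lie_antisym)
  qed (use * in \<open>simp_all add: lie_self\<close>)
qed

text \<open>Biadditivity reduces a bracket of two commutators to brackets of spanning elements of
  smaller degree in a, so the degrees 0, 1 and 2 are treated in a single induction.\<close>

lemma iter_comm_span:
  assumes "iter_comm k m x"
  shows "k = 1 \<Longrightarrow> x \<in> group_closure {C m}"
    and "k = 2 \<Longrightarrow> x \<in> group_closure (brackets2 m)"
proof -
  \<comment> \<open>Spanning sets in degree 0: a commutator in b alone is b itself or 0.\<close>
  define S0 :: "nat \<Rightarrow> L set" where "S0 m = (if m = 1 then {gen_b} else {})" for m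
  have b_b: "[s, t]\<^sub>L \<in> group_closure (S0 (m + m'))" if "s \<in> S0 m" "t \<in> S0 m'" for s t m m'
    using that by (simp add: S0_def lie_self split: if_splits)
  have C_b: "[s, t]\<^sub>L \<in> group_closure {C (m + m')}" if "s \<in> {C m}" "t \<in> S0 m'" for s t m m'
    using that by (intro group_closure.base) (simp add: S0_def split: if_splits)
  have b_C: "[s, t]\<^sub>L \<in> group_closure {C (m + m')}" if "s \<in> S0 m" "t \<in> {C m'}" for s t m m'
    using C_b[OF that(2,1)] lie_antisym[of s t] by (simp add: add.commute)
  have C_C: "[s, t]\<^sub>L \<in> group_closure (brackets2 (m + m'))" if "s \<in> {C m}" "t \<in> {C m'}" for s t m m'
    using that C_bracket_in_brackets2 by simp
  have s_b: "[s, t]\<^sub>L \<in> group_closure (brackets2 (m + m'))"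
    if "s \<in> brackets2 m" "t \<in> S0 m'" for s t m m'
  proof -
    from that obtain j where j: "2 * j < m" "s = [C (m - j), C j]\<^sub>L" and t: "t = gen_b" "m' = 1"
      unfolding brackets2_def S0_def by (auto split: if_splits)
    \<comment> \<open>The derivation rule raises one of the two indices. The new pair may violate 2
      j < m, which \<open>C_bracket_in_brackets2\<close> absorbs.\<close>
    then have "[s, t]\<^sub>L = [C (Suc (m - j)), C j]\<^sub>L + [C (m - j), C (Suc j)]\<^sub>L"
      using lie_derivation[of "C (m - j)" "C j" gen_b] by simp
    moreover have "Suc (m - j) + j = m + m'" "m - j + Suc j = m + m'" using j t by auto
    ultimately show ?thesis
      by (metis C_bracket_in_brackets2 group_closure_add)
  qed
  have b_s: "[s, t]\<^sub>L \<in> group_closure (brackets2 (m + m'))"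
    if "s \<in> S0 m" "t \<in> brackets2 m'" for s t m m'
    using s_b[OF that(2,1)] lie_antisym[of s t] by (simp add: add.commute)
  have "(k = 0 \<longrightarrow> x \<in> group_closure (S0 m)) \<and>
      (k = 1 \<longrightarrow> x \<in> group_closure {C m}) \<and> (k = 2 \<longrightarrow> x \<in> group_closure (brackets2 m))"
    using assms
  proof (induction rule: iter_comm.induct)
    case letter_a
    show ?case by (auto intro!: group_closure.base)
  next
    case letter_b
    show ?case by (auto intro!: group_closure.base simp: S0_def)
  next
    case (bracket k m x k' m' y)
    have "k = 0 \<and> k' = 0 \<or> k = 0 \<and> k' = 1 \<or> k = 1 \<and> k' = 0 \<or> k = 1 \<and> k' = 1
        \<or> k = 0 \<and> k' = 2 \<or> k = 2 \<and> k' = 0 \<or> k + k' > 2"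
      by presburger
    then consider "k = 0" "k' = 0" | "k = 0" "k' = 1" | "k = 1" "k' = 0" | "k = 1" "k' = 1"
      | "k = 0" "k' = 2" | "k = 2" "k' = 0" | "k + k' > 2" by blast
    then show ?case
    proof cases
      case 1
      then have "x \<in> group_closure (S0 m)" "y \<in> group_closure (S0 m')"
        using bracket.IH by simp_all
      then have "[x, y]\<^sub>L \<in> group_closure (S0 (m + m'))"
        by (rule group_closure_lie_bracket[rotated]) (erule (1) b_b)
      then show ?thesis using 1 by simp
    next
      case 2
      then have "x \<in> group_closure (S0 m)" "y \<in> group_closure {C m'}"
        using bracket.IH by simp_all
      then have "[x, y]\<^sub>L \<in> group_closure {C (m + m')}"
        by (rule group_closure_lie_bracket[rotated]) (erule (1) b_C)
      then show ?thesis using 2 by simp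
    next
      case 3
      then have "x \<in> group_closure {C m}" "y \<in> group_closure (S0 m')"
        using bracket.IH by simp_all
      then have "[x, y]\<^sub>L \<in> group_closure {C (m + m')}"
        by (rule group_closure_lie_bracket[rotated]) (erule (1) C_b)
      then show ?thesis using 3 by simp
    next
      case 4
      then have "x \<in> group_closure {C m}" "y \<in> group_closure {C m'}"
        using bracket.IH by simp_all
      then have "[x, y]\<^sub>L \<in> group_closure (brackets2 (m + m'))"
        by (rule group_closure_lie_bracket[rotated]) (erule (1) C_C)
      then show ?thesis using 4 by simp
    next
      case 5
      then have "x \<in> group_closure (S0 m)" "y \<in> group_closure (brackets2 m')"
        using bracket.IH by simp_all
      then have "[x, y]\<^sub>L \<in> group_closure (brackets2 (m + m'))"
        by (rule group_closure_lie_bracket[rotated]) (erule (1) b_s)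
      then show ?thesis using 5 by simp
    next
      case 6
      then have "x \<in> group_closure (brackets2 m)" "y \<in> group_closure (S0 m')"
        using bracket.IH by simp_all
      then have "[x, y]\<^sub>L \<in> group_closure (brackets2 (m + m'))"
        by (rule group_closure_lie_bracket[rotated]) (erule (1) s_b)
      then show ?thesis using 6 by simp
    qed auto
  qed
  then show "k = 1 \<Longrightarrow> x \<in> group_closure {C m}"
    and "k = 2 \<Longrightarrow> x \<in> group_closure (brackets2 m)" by simp_all
qed

lemma group_closure_least:
  assumes "x \<in> group_closure S" "S \<subseteq> group_closure T"
  shows "x \<in> group_closure T"
  using assms(1)
  by (induction rule: group_closure.induct) (use assms(2) in \<open>auto intro: group_closure.diff\<close>)

lemma group_closure_sum_mem:
  assumes "\<And>i. i \<in> I \<Longrightarrow> f i \<in> group_closure S"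
  shows "sum f I \<in> group_closure S"
  using assms by (induction I rule: infinite_finite_induct) (auto intro: group_closure_add)

lemma L_deg_1_span: "x \<in> L_deg 1 m \<Longrightarrow> x \<in> group_closure {C m}"
  unfolding L_deg_def by (erule group_closure_least) (auto intro: iter_comm_span(1))

lemma L_deg_2_span: "x \<in> L_deg 2 m \<Longrightarrow> x \<in> group_closure (brackets2 m)"
  unfolding L_deg_def by (erule group_closure_least) (auto intro: iter_comm_span(2))

lemma iter_comm_C: "iter_comm 1 m (C m)"
proof (induction m)
  case 0
  show ?case by (simp add: iter_comm.letter_a[simplified])
next
  case (Suc m)
  from iter_comm.bracket[OF this iter_comm.letter_b] show ?case by simp
qed


section \<open>A polynomial model\<close>

text \<open>
  The semidirect product of the multiples of \<open>b\<close> with a nilpotent Lie ring of class 2: \<open>b\<close> acts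
  by the weights \<open>X\<close> and \<open>1\<close> on the components \<open>wt_X\<close> and \<open>wt_1\<close>, hence by \<open>X + 1\<close> on the
  bracket of the two, which lies in \<open>area\<close>.
\<close>

datatype model = Model (b_part: "int poly") (wt_X: "int poly") (wt_1: "int poly") (area: "int poly")

instantiation model :: lie_ring
begin

definition "0 = Model 0 0 0 0"
definition "- u = Model (- b_part u) (- wt_X u) (- wt_1 u) (- area u)"
definition "u + v = Model (b_part u + b_part v) (wt_X u + wt_X v) (wt_1 u + wt_1 v) (area u + area v)"
definition "u - v = Model (b_part u - b_part v) (wt_X u - wt_X v) (wt_1 u - wt_1 v) (area u - area v)"
definition "[u, v]\<^sub>L = Model 0
  ([:0, 1:] * (b_part v * wt_X u - b_part u * wt_X v))
  (b_part v * wt_1 u - b_part u * wt_1 v)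
  (([:0, 1:] + 1) * (b_part v * area u - b_part u * area v) + wt_X u * wt_1 v - wt_X v * wt_1 u)"

instance
proof
  fix u v w :: model
  show "[u, [v, w]\<^sub>L]\<^sub>L + [v, [w, u]\<^sub>L]\<^sub>L + [w, [u, v]\<^sub>L]\<^sub>L = 0"
    unfolding zero_model_def plus_model_def lie_bracket_model_def model.sel model.inject
    \<comment> \<open>\<open>[:0, 1:]\<close> stays an opaque factor, so that only commutative ring
      arithmetic is left.\<close>
    by (intro conjI; simp del: mult_pCons_left mult_pCons_right add: ring_distribs mult_ac)
  show "[u + v, w]\<^sub>L = [u, w]\<^sub>L + [v, w]\<^sub>L" "[u, v + w]\<^sub>L = [u, v]\<^sub>L + [u, w]\<^sub>L"
    unfolding plus_model_def lie_bracket_model_def model.sel model.inject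
    by (intro conjI; simp del: mult_pCons_left mult_pCons_right add: algebra_simps)+
  show "[u, u]\<^sub>L = 0"
    unfolding zero_model_def lie_bracket_model_def by simp
qed (simp_all add: zero_model_def uminus_model_def plus_model_def minus_model_def)

end

text \<open>The letter a has entry 1 in both weight components, so that n brackets with b separate
  them into X^n and 1.\<close>

definition to_model :: "L \<Rightarrow> model" where
  "to_model = free_lie_lift (\<lambda>l. case l of letter_a \<Rightarrow> Model 0 1 1 0 | letter_b \<Rightarrow> Model 1 0 0 0)"

lemma free_lie_lift_simps:
  "free_lie_lift f (free_gen l) = f l"
  "free_lie_lift f (x + y) = free_lie_lift f x + free_lie_lift f y"
  "free_lie_lift f [x, y]\<^sub>L = [free_lie_lift f x, free_lie_lift f y]\<^sub>L"
  by (transfer, simp)+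

lemma to_model_gen:
  "to_model gen_a = Model 0 1 1 0" "to_model gen_b = Model 1 0 0 0"
  by (simp_all add: to_model_def gen_a_def gen_b_def free_lie_lift_simps)

lemma to_model_add: "to_model (x + y) = to_model x + to_model y"
  by (simp add: to_model_def free_lie_lift_simps)

lemma to_model_bracket: "to_model [x, y]\<^sub>L = [to_model x, to_model y]\<^sub>L"
  by (simp add: to_model_def free_lie_lift_simps)

lemma to_model_0: "to_model 0 = Model 0 0 0 0"
  using to_model_add[of 0 0] by (simp add: zero_model_def[symmetric])

lemma to_model_diff: "to_model (x - y) = to_model x - to_model y"
  using to_model_add[of "x - y" y] by (simp add: algebra_simps)

lemma to_model_C: "to_model (C n) = Model 0 ([:0, 1:] ^ n) 1 0"
  by (induction n) (simp_all add: to_model_gen to_model_bracket lie_bracket_model_def)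

lemma to_model_C_bracket:
  "to_model [C i, C j]\<^sub>L = Model 0 0 0 ([:0, 1:] ^ i - [:0, 1:] ^ j)"
  by (simp add: to_model_bracket to_model_C lie_bracket_model_def)

lemma area_Theta:
  "area (to_model (Theta (A, B))) =
    ([:0, 1:] + 1) * area (to_model B) + wt_X (to_model A) - wt_1 (to_model A)"
  by (simp add: Theta_def to_model_add to_model_bracket to_model_gen plus_model_def
      lie_bracket_model_def)

section \<open>Consequences of the model for the kernel\<close>

lemma X_power: "[:0, 1 :: int:] ^ n = monom 1 n"
  by (simp add: monom_altdef)

text \<open>The spanning bracket with index j has area X^(m-j) - X^j. Since m - j > m/2, its only
  coefficient in degrees below m/2 is -1 at X^j, so the negated coefficients are dual
  functionals.\<close>

lemma L_deg_2_eq_0_if_area_0: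
  assumes "x \<in> L_deg 2 m" "area (to_model x) = 0"
  shows "x = 0"
proof (rule group_closure_eq_0_if_coordinates_0[where \<phi> = "\<lambda>i x. - coeff (area (to_model x)) i"])
  show "x \<in> group_closure ((\<lambda>j. [C (m - j), C j]\<^sub>L) ` {j. 2 * j < m})"
    using L_deg_2_span[OF assms(1)] by (simp add: brackets2_def)
  show "finite {j. 2 * j < m}"
    by (rule finite_subset[of _ "{..m}"]) auto
  show "- coeff (area (to_model [C (m - j), C j]\<^sub>L)) i = (if i = j then 1 else 0)"
    if "i \<in> {j. 2 * j < m}" "j \<in> {j. 2 * j < m}" for i j
    using that by (auto simp: to_model_C_bracket X_power)
qed (use assms(2) in \<open>simp_all add: to_model_diff minus_model_def\<close>)

text \<open>Bracketing with b is injective in degree 2 because X + 1 is not a zero divisor.\<close>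

lemma kernel_eq_0_if_fst_eq_0:
  assumes "(0, B) \<in> I2 m"
  shows "B = 0"
proof -
  have B: "B \<in> L_deg 2 (m - 1)" and "Theta (0, B) = 0"
    using assms by (auto simp: I2_def)
  then have "([:0, 1:] + 1) * area (to_model B) = 0"
    using area_Theta[of 0 B] by (simp add: to_model_0)
  moreover have "[:0, 1:] + 1 \<noteq> (0 :: int poly)"
    by (simp add: one_pCons)
  ultimately have "area (to_model B) = 0" using mult_eq_0_iff by blast
  with B show ?thesis by (rule L_deg_2_eq_0_if_area_0)
qed

lemma odd_kernel_fst_eq_0:
  assumes "(A, B) \<in> I2 m" "odd m"
  shows "A = 0"
proof -
  from assms have A: "A \<in> group_closure {C m}" and T: "Theta (A, B) = 0"
    using L_deg_1_span by (auto simp: I2_def)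
  \<comment> \<open>For A = c C m this reads X^m c, with c recovered as \<open>wt_1\<close>.\<close>
  from A have wt: "wt_X (to_model A) = [:0, 1:] ^ m * wt_1 (to_model A)"
    by (induction rule: group_closure.induct)
      (auto simp: to_model_0 to_model_C to_model_diff minus_model_def algebra_simps)
  have "([:0, 1:] + 1) * area (to_model B) + wt_X (to_model A) - wt_1 (to_model A) = 0"
    using area_Theta[of A B] by (simp add: T to_model_0)
  \<comment> \<open>The point -1 is the root of X + 1, so the contribution of B vanishes and c
    ((-1)^m - 1) = -2 c = 0 remains.\<close>
  then have "poly (([:0, 1:] + 1) * area (to_model B) + wt_X (to_model A) - wt_1 (to_model A)) (- 1) = 0"
    by simp
  then have zero: "poly (wt_1 (to_model A)) (- 1) = 0"
    using \<open>odd m\<close> by (simp add: wt)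
  show ?thesis
  proof (rule group_closure_eq_0_if_coordinates_0[where J = "{m}" and s = C
        and \<phi> = "\<lambda>_ x. poly (wt_1 (to_model x)) (- 1)"])
    show "A \<in> group_closure (C ` {m})" using A by simp
  qed (simp_all add: zero to_model_diff minus_model_def to_model_C)
qed


section \<open>The kernel\<close>

lemma I2_diff:
  assumes "p \<in> I2 m" "q \<in> I2 m"
  shows "p - q \<in> I2 m"
proof -
  have "Theta (p - q) = Theta p - Theta q"
    by (simp add: Theta_def case_prod_unfold lie_diff_left)
  with assms show ?thesis
    by (auto simp: I2_def L_deg_def intro: group_closure.diff)
qed

lemma zero_in_I2: "0 \<in> I2 m"
  by (auto simp: I2_def L_deg_def Theta_def zero_prod_def)

definition alt_sum :: "nat \<Rightarrow> L" where
  "alt_sum m = (\<Sum>i = 1..m div 2.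
    if even i then [C (m - i), C (i - 1)]\<^sub>L else - [C (m - i), C (i - 1)]\<^sub>L)"

lemma alt_sum_in_L_deg: "alt_sum m \<in> L_deg 2 (m - 1)"
proof -
  have "[C (m - i), C (i - 1)]\<^sub>L \<in> L_deg 2 (m - 1)" if "i \<in> {1..m div 2}" for i
  proof -
    \<comment> \<open>The subtractions are not truncated, since 1 \<le> i \<le> m.\<close>
    have "m - i + (i - 1) = m - 1" using that by auto
    then show ?thesis
      using iter_comm.bracket[OF iter_comm_C[of "m - i"] iter_comm_C[of "i - 1"]]
      by (auto simp: L_deg_def numeral_2_eq_2 intro!: group_closure.base)
  qed
  then show ?thesis
    unfolding alt_sum_def L_deg_def by (intro group_closure_sum_mem) auto
qed

text \<open>By the derivation rule the i-th summand becomes u i - u (i - 1), where u i is (-1)^i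
  \<open>[C (m - i), C i]\<^sub>L\<close>. The sum telescopes to -u 0; evenness makes the last term
  a bracket of \<open>C (m div 2)\<close> with itself.\<close>

lemma alt_sum_bracket:
  assumes "even m"
  shows "[alt_sum m, gen_b]\<^sub>L = - [C m, gen_a]\<^sub>L"
proof -
  define u where "u i = (if even i then [C (m - i), C i]\<^sub>L else - [C (m - i), C i]\<^sub>L)" for i
  have "[if even i then [C (m - i), C (i - 1)]\<^sub>L else - [C (m - i), C (i - 1)]\<^sub>L, gen_b]\<^sub>L
      = u i - u (i - 1)" if i: "i \<in> {1..m div 2}" for i
  proof -
    obtain j where j: "i = Suc j" using i by (cases i) auto
    then have "m - j = Suc (m - i)" using i by auto
    then show ?thesis
      using lie_derivation[of "C (m - i)" "C j" gen_b] by (simp add: u_def j lie_neg_left)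
  qed
  then have "[alt_sum m, gen_b]\<^sub>L = (\<Sum>i = 1..m div 2. u i - u (i - 1))"
    unfolding alt_sum_def lie_sum_left by (intro sum.cong) auto
  also have "\<dots> = u (m div 2) - u 0"
    using sum_telescope''[of 0 "m div 2" u] by simp
  also have "u (m div 2) = 0"
  proof -
    have "m - m div 2 = m div 2" using assms by auto
    then show ?thesis by (simp add: u_def lie_self)
  qed
  finally show ?thesis by (simp add: u_def)
qed

lemma generator_in_I2:
  assumes "even m"
  shows "(C m, alt_sum m) \<in> I2 m"
  using alt_sum_in_L_deg[of m] iter_comm_C[of m] alt_sum_bracket[OF assms]
  by (auto simp: I2_def Theta_def L_deg_def intro!: group_closure.base)

lemma I2_odd:
  assumes "odd m"
  shows "I2 m = {0}"
proof -
  have "p = 0" if "p \<in> I2 m" for p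
    using that odd_kernel_fst_eq_0[OF _ assms] kernel_eq_0_if_fst_eq_0
    by (cases p) (auto simp: zero_prod_def)
  then show ?thesis using zero_in_I2 by auto
qed

lemma I2_even:
  assumes "even m"
  shows "I2 m = group_closure {(C m, alt_sum m)}"
proof (intro equalityI subsetI)
  fix p assume "p \<in> group_closure {(C m, alt_sum m)}"
  then show "p \<in> I2 m"
    by (induction rule: group_closure.induct)
      (use generator_in_I2[OF assms] zero_in_I2 I2_diff in auto)
next
  fix p assume p: "p \<in> I2 m"
  then have "fst p \<in> group_closure {C m}"
    using L_deg_1_span by (auto simp: I2_def)
  \<comment> \<open>A multiple of the generator with the same first component as p is built by
    induction, without naming the integer factor. Membership of q in \<open>I2 m\<close> puts p - q
    into the kernel with first component 0, which forces p = q.\<close>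
  then have "\<exists>q \<in> group_closure {(C m, alt_sum m)} \<inter> I2 m. fst q = fst p"
  proof (induction rule: group_closure.induct)
    case (base s)
    have "(C m, alt_sum m) \<in> group_closure {(C m, alt_sum m)}"
      by (intro group_closure.base) simp
    then show ?case
      using base generator_in_I2[OF assms] zero_in_I2
      by (intro bexI[where x = "if s = 0 then 0 else (C m, alt_sum m)"]) auto
  next
    case (diff s t)
    then show ?case
      by (metis IntD1 IntD2 IntI I2_diff fst_diff group_closure.diff)
  qed
  then obtain q where q: "q \<in> group_closure {(C m, alt_sum m)}" "q \<in> I2 m" "fst q = fst p"
    by auto
  have "p - q = (0, snd (p - q))" using q(3) by (simp add: prod_eq_iff)
  then have "snd (p - q) = 0"
    using kernel_eq_0_if_fst_eq_0 I2_diff[OF p q(2)] by metis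
  then have "p = q" using q(3) by (simp add: prod_eq_iff)
  then show "p \<in> group_closure {(C m, alt_sum m)}" using q(1) by simp
qed

theorem theorem1p5:
  fixes m :: nat
  assumes "m \<ge> 1"
  shows "(odd m \<longrightarrow> I2 m = {0}) \<and>
    (even m \<longrightarrow> I2 m = group_closure
      {(C m, \<Sum>i = 1..m div 2.
          if even i then [C (m - i), C (i - 1)]\<^sub>L else - [C (m - i), C (i - 1)]\<^sub>L)})"
  using I2_odd I2_even unfolding alt_sum_def by blast

end
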